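(* Let $k,m\ge1$. For $\mathbf{y}\in\mathbb{Z}_{\ge0}^k$, the number $|\operatorname{PS}_k^m(\mathbf{y})\cap\mathbb{Z}^{km}|$ is given by a polynomial in $\mathbb{Q}[y_1,\ldots,y_k]$ with nonnegative coefficients.
   Context: For $\mathbf{y}\in\mathbb{Z}_{\ge0}^k$ set $\tilde y_i=y_1+\cdots+y_i$. The polytope $\operatorname{PS}_k^m(\mathbf{y})$ is the set of points $(x_{i,j})_{i\in[k],j\in[m]}\in\mathbb{R}^{km}$ satisfying $0\le x_{i,1}\le x_{i,2}\le\cdots\le x_{i,m}\le\tilde y_i$ for all $i\in[k]$, and $x_{i,j}\le x_{i+1,j}$ for all $i\in[k-1]$, $j\in[m]$ (the $m$-generalized Pitman–Stanley polytope with $\mathbf{z}=\mathbf{0}$). *)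

theory Defs
  imports Complex_Main "HOL-Library.FuncSet" "HOL-Library.Poly_Mapping"
begin

text \<open>
  The space of real \<open>k \<times> m\<close> arrays \<open>(x\<^sub>i\<^sub>,\<^sub>j)\<close> is represented by the functions on
  \<open>{1..k} \<times> {1..m}\<close> that are extensional (i.e. \<open>undefined\<close> outside that index set),
  so that distinct functions are distinct points.
\<close>

definition real_arrays :: "nat \<Rightarrow> nat \<Rightarrow> (nat \<times> nat \<Rightarrow> real) set" where
  "real_arrays k m = ({1..k} \<times> {1..m}) \<rightarrow>\<^sub>E UNIV"

definition int_arrays :: "nat \<Rightarrow> nat \<Rightarrow> (nat \<times> nat \<Rightarrow> real) set" where
  "int_arrays k m = ({1..k} \<times> {1..m}) \<rightarrow>\<^sub>E \<int>"

text \<open>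
  A vector \<open>y \<in> \<int>\<^sub>\<ge>\<^sub>0\<^sup>k\<close> is given by a function \<open>y\<close> on the naturals, of which only the
  values \<open>y 1, \<dots>, y k\<close> are ever used.
\<close>

definition psum :: "(nat \<Rightarrow> nat) \<Rightarrow> nat \<Rightarrow> nat" where
  "psum y i = (\<Sum>l = 1..i. y l)"

definition PS :: "nat \<Rightarrow> nat \<Rightarrow> (nat \<Rightarrow> nat) \<Rightarrow> (nat \<times> nat \<Rightarrow> real) set" where
  "PS k m y = {x \<in> real_arrays k m.
     (\<forall>i\<in>{1..k}. 0 \<le> x (i, 1)
        \<and> (\<forall>j\<in>{1..<m}. x (i, j) \<le> x (i, j + 1))
        \<and> x (i, m) \<le> real (psum y i))
     \<and> (\<forall>i\<in>{1..<k}. \<forall>j\<in>{1..m}. x (i, j) \<le> x (i + 1, j))}"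

text \<open>
  Multivariate polynomials over \<open>\<rat>\<close> are finitely supported maps from monomials to
  coefficients, where a monomial is a finitely supported map from variable indices to
  exponents; \<open>rat_polys k\<close> is \<open>\<rat>[y\<^sub>1, \<dots>, y\<^sub>k]\<close>.
\<close>

type_synonym rat_mpoly = "(nat \<Rightarrow>\<^sub>0 nat) \<Rightarrow>\<^sub>0 rat"

definition rat_polys :: "nat \<Rightarrow> rat_mpoly set" where
  "rat_polys k = {p. \<forall>t\<in>Poly_Mapping.keys p. Poly_Mapping.keys t \<subseteq> {1..k}}"

definition eval_mpoly :: "rat_mpoly \<Rightarrow> (nat \<Rightarrow> rat) \<Rightarrow> rat" where
  "eval_mpoly p v = (\<Sum>t\<in>Poly_Mapping.keys p.
     Poly_Mapping.lookup p t * (\<Prod>i\<in>Poly_Mapping.keys t. v i ^ Poly_Mapping.lookup t i))"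

end

theory Submission
  imports Defs "Jordan_Normal_Form.Determinant"
begin

text \<open>
  The superlevel sets of a lattice point form a decreasing chain of up-sets of the grid
  \<open>[k] \<times> [m]\<close>, and the chain may contain cells of row \<open>i\<close> only up to level \<open>y\<^sub>1 + \<dots> + y\<^sub>i\<close>.
  Cutting the chain at these levels writes the count as a sum of products of numbers
  \<open>\<Omega>\<^sub>p\<^sub>q(y\<^sub>i)\<close>, where \<open>\<Omega>\<^sub>p\<^sub>q(n)\<close> is the number of multichains of length \<open>n\<close> from the up-set \<open>p\<close>
  down to \<open>q\<close>. It remains to see that \<open>\<Omega>\<^sub>p\<^sub>q\<close> is a polynomial with nonnegative coefficients.

  Kreweras' determinant gives the polynomial. Since \<open>\<Omega>(x + y) = \<Omega>(x) \<Omega>(y)\<close> as matrices, one has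
  \<open>\<Omega>' = L \<Omega>\<close> where \<open>L\<close> consists of the linear coefficients, so it suffices that these are
  nonnegative. If the skew shape between \<open>p\<close> and \<open>q\<close> is disconnected, the determinant is a product;
  if it is connected with \<open>k\<close> rows and \<open>a\<close> columns, the linear coefficient is
  \<open>(a - 1)! (k - 1)! / (a + k - 1)!\<close>.
\<close>

subsection \<open>Row-wise expansion of determinants\<close>

text \<open>Laplace expansion along row \<open>t\<close>: the cofactors of that row do not involve
  its entries, so one \<open>c\<close> serves every \<open>u\<close>.\<close>

lemma det_row_expand:
  fixes G :: "nat \<Rightarrow> nat \<Rightarrow> 'a :: comm_ring_1"
  assumes "t < k"
  shows "\<exists>c. \<forall>u. det (mat k k (\<lambda>(i, j). if i = t then u j else G i j)) = (\<Sum>j<k. u j * c j)"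
proof (intro exI allI)
  fix u :: "nat \<Rightarrow> 'a"
  let ?A = "\<lambda>u. mat k k (\<lambda>(i, j). if i = t then u j else G i j)"
  have del: "mat_delete (?A u) t j = mat_delete (?A (\<lambda>_. 0)) t j" for j
    by (rule eq_matI) (auto simp: mat_delete_def)
  have "det (?A u) = (\<Sum>j<k. ?A u $$ (t, j) * cofactor (?A u) t j)"
    using assms by (intro laplace_expansion_row) auto
  also have "\<dots> = (\<Sum>j<k. u j * cofactor (?A (\<lambda>_. 0)) t j)"
    using assms by (intro sum.cong) (auto simp: cofactor_def del)
  finally show "det (?A u) = (\<Sum>j<k. u j * cofactor (?A (\<lambda>_. 0)) t j)" .
qed

text \<open>By linearity in row \<open>t\<close> the differences telescope. \<open>F\<close> takes
  integers so that the lower boundary term makes sense for \<open>a = 0\<close>.\<close>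

lemma det_row_telescope:
  fixes G :: "nat \<Rightarrow> nat \<Rightarrow> 'a :: comm_ring_1" and F :: "int \<Rightarrow> nat \<Rightarrow> 'a"
  assumes "t < k" "a \<le> b"
  shows "(\<Sum>s = a..b. det (mat k k (\<lambda>(i, j). if i = t then F (int s) j - F (int s - 1) j else G i j)))
    = det (mat k k (\<lambda>(i, j). if i = t then F (int b) j else G i j))
      - det (mat k k (\<lambda>(i, j). if i = t then F (int a - 1) j else G i j))"
proof -
  obtain c where c: "\<And>u. det (mat k k (\<lambda>(i, j). if i = t then u j else G i j)) = (\<Sum>j<k. u j * c j)"
    using det_row_expand[OF assms(1), of G] by blast
  let ?h = "\<lambda>s. \<Sum>j<k. F s j * c j"
  have "(\<Sum>s = a..b. ?h (int s) - ?h (int s - 1)) = ?h (int b) - ?h (int a - 1)"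
    using assms(2) by (induction b rule: dec_induct) auto
  moreover have "det (mat k k (\<lambda>(i, j). if i = t then F (int s) j - F (int s - 1) j else G i j))
      = ?h (int s) - ?h (int s - 1)" for s
    using c[of "\<lambda>j. F (int s) j - F (int s - 1) j"]
    by (simp add: left_diff_distrib sum_subtractf)
  ultimately show ?thesis by (simp add: c)
qed

subsection \<open>Complete homogeneous polynomials at a formal number of ones\<close>

text \<open>For a natural number \<open>x\<close> this is the complete homogeneous symmetric polynomial of
  degree \<open>a\<close> evaluated at \<open>x\<close> ones.\<close>

definition hom_ones :: "int \<Rightarrow> rat \<Rightarrow> rat" where
  "hom_ones a x = (if a < 0 then 0 else pochhammer x (nat a) / fact (nat a))"

text \<open>The recursion of complete homogeneous polynomials: a monomial in \<open>x + 1\<close>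
  variables either avoids the last variable or is divisible by it. For rational \<open>x\<close> it
  is an identity of rising factorials.\<close>

lemma hom_ones_diff: "hom_ones a x = hom_ones a (x + 1) - hom_ones (a - 1) (x + 1)"
proof (cases "a \<le> 0")
  case True
  then show ?thesis by (auto simp: hom_ones_def)
next
  case False
  then obtain n where n: "a = int (Suc n)"
    by (metis nonneg_int_cases not_le order_less_imp_le of_nat_0_less_iff gr0_implies_Suc)
  have "pochhammer (x + 1) (Suc n) = pochhammer (x + 1) n * (x + 1 + of_nat n)"
    by (simp add: pochhammer_Suc)
  moreover have "pochhammer x (Suc n) = x * pochhammer (x + 1) n"
    by (simp add: pochhammer_rec)
  moreover have "nat (int (Suc n)) = Suc n" "nat (int (Suc n) - 1) = n" by auto
  ultimately show ?thesis
    unfolding hom_ones_def n by (simp add: field_simps del: pochhammer_Suc of_nat_Suc) (simp add: algebra_simps)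
qed

text \<open>Row \<open>i\<close> of Kreweras' matrix with the part \<open>p i\<close> replaced by a
  free integer \<open>s\<close>, which may also be \<open>-1\<close>.\<close>

definition hrow :: "rat \<Rightarrow> (nat \<Rightarrow> nat) \<Rightarrow> nat \<Rightarrow> int \<Rightarrow> nat \<Rightarrow> rat" where
  "hrow x q i s j = hom_ones (s - int (q j) + int i - int j) (x + of_int (int j - int i))"

lemma hrow_diff: "hrow x q i s j = hrow (x + 1) q i s j - hrow (x + 1) q i (s - 1) j"
  using hom_ones_diff[of "s - int (q j) + int i - int j" "x + of_int (int j - int i)"]
  by (simp add: hrow_def algebra_simps)

text \<open>For fixed \<open>q\<close> and \<open>j\<close> the entry depends only on
  \<open>s + i\<close> and \<open>x - i\<close>. This coincidence of neighbouring rows is what makes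
  the boundary terms of the telescoping sums vanish.\<close>

lemma hrow_Suc: "hrow (x + 1) q (Suc i) (s - 1) j = hrow x q i s j"
  by (simp add: hrow_def algebra_simps)

subsection \<open>The determinant of a skew shape\<close>

definition skew_det :: "nat \<Rightarrow> rat \<Rightarrow> (nat \<Rightarrow> nat) \<Rightarrow> (nat \<Rightarrow> nat) \<Rightarrow> rat" where
  "skew_det k x p q = det (mat k k (\<lambda>(i, j). hrow x q i (int (p i)) j))"

text \<open>The up-sets inside the shape \<open>p\<close>, each encoded by its row lengths;
  extensionality makes the set finite.\<close>

definition below :: "nat \<Rightarrow> (nat \<Rightarrow> nat) \<Rightarrow> (nat \<Rightarrow> nat) set" where
  "below k p = {r \<in> {..<k} \<rightarrow>\<^sub>E UNIV. mono_on {..<k} r \<and> (\<forall>i<k. r i \<le> p i)}"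

lemma finite_below: "finite (below k p)"
proof (rule finite_subset)
  show "below k p \<subseteq> (\<Pi>\<^sub>E i\<in>{..<k}. {..p i})"
    by (auto simp: below_def PiE_def Pi_def)
qed (auto intro!: finite_PiE)

lemma below_0: "below 0 p = {\<lambda>_. undefined}"
  by (auto simp: below_def monotone_on_def)

lemma mono_on_fun_upd_Suc:
  assumes "mono_on {..<t} r" "t > 0 \<Longrightarrow> r (t - 1) \<le> s"
  shows "mono_on {..<Suc t} (r(t := s :: nat))"
proof (rule mono_onI)
  fix i j assume ij: "i \<in> {..<Suc t}" "j \<in> {..<Suc t}" "i \<le> j"
  show "(r(t := s)) i \<le> (r(t := s)) j"
  proof (cases "i < t \<and> j = t")
    case True
    then have "r i \<le> r (t - 1)" using assms(1) by (auto intro: mono_onD)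
    then show ?thesis using True assms(2) by auto
  next
    case False
    then show ?thesis using ij assms(1) by (auto intro: mono_onD simp: le_less_Suc_eq)
  qed
qed

lemma below_Suc_bij:
  "bij_betw (\<lambda>(r, s). r(t := s))
     (SIGMA r:below t p. {(if t = 0 then 0 else r (t - 1))..p t}) (below (Suc t) p)"
proof (rule bij_betwI[where g = "\<lambda>r. (r(t := undefined), r t)"])
  show "(\<lambda>(r, s). r(t := s)) \<in>
    (SIGMA r:below t p. {(if t = 0 then 0 else r (t - 1))..p t}) \<rightarrow> below (Suc t) p"
    by (auto simp: below_def less_Suc_eq PiE_def extensional_def intro!: mono_on_fun_upd_Suc
             split: if_splits)
  show "(\<lambda>r. (r(t := undefined), r t)) \<in> below (Suc t) p \<rightarrow>
    (SIGMA r:below t p. {(if t = 0 then 0 else r (t - 1))..p t})"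
    by (auto simp: below_def PiE_def extensional_def mono_on_def)
next
  fix z assume "z \<in> (SIGMA r:below t p. {(if t = 0 then 0 else r (t - 1))..p t})"
  then show "(\<lambda>r. (r(t := undefined), r t)) ((\<lambda>(r, s). r(t := s)) z) = z"
    by (auto simp: below_def PiE_def extensional_def)
qed auto

text \<open>The stage of the row by row summation at which the rows from \<open>t\<close> on have been summed.\<close>

definition mixed_det ::
    "nat \<Rightarrow> rat \<Rightarrow> (nat \<Rightarrow> nat) \<Rightarrow> (nat \<Rightarrow> nat) \<Rightarrow> nat \<Rightarrow> (nat \<Rightarrow> nat) \<Rightarrow> rat" where
  "mixed_det k x p q t r = det (mat k k (\<lambda>(i, j).
     if i < t then hrow x q i (int (r i)) j else hrow (x + 1) q i (int (p i)) j))"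

text \<open>Summing over \<open>s\<close> telescopes, and the lower boundary term duplicates row \<open>t - 1\<close>.\<close>

lemma mixed_det_row_sum:
  assumes "t < k" "(if t = 0 then 0 else r (t - 1)) \<le> p t"
  shows "(\<Sum>s = (if t = 0 then 0 else r (t - 1))..p t. mixed_det k x p q (Suc t) (r(t := s)))
    = mixed_det k x p q t r"
proof -
  define G where "G = (\<lambda>i j. if i < t then hrow x q i (int (r i)) j else hrow (x + 1) q i (int (p i)) j)"
  define F where "F = hrow (x + 1) q t"
  define a where "a = (if t = 0 then 0 else r (t - 1))"
  let ?M = "\<lambda>u. mat k k (\<lambda>(i, j). if i = t then u j else G i j)"
  have "mixed_det k x p q (Suc t) (r(t := s)) = det (?M (\<lambda>j. F (int s) j - F (int s - 1) j))" for s
    unfolding mixed_det_def F_def G_def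
    by (intro arg_cong[where f = det] eq_matI) (auto simp: hrow_diff[of x q t, symmetric])
  then have "(\<Sum>s = a..p t. mixed_det k x p q (Suc t) (r(t := s)))
      = det (?M (F (int (p t)))) - det (?M (F (int a - 1)))"
    using det_row_telescope[OF assms(1), of a "p t" F G] assms(2) by (simp add: a_def)
  also have "det (?M (F (int (p t)))) = mixed_det k x p q t r"
    unfolding mixed_det_def F_def G_def by (intro arg_cong[where f = det] eq_matI) auto
  also have "det (?M (F (int a - 1))) = 0"
  proof (cases t)
    case 0
    \<comment> \<open>In row 0 the boundary value is \<open>-1\<close>, so every entry has negative
      degree.\<close>
    then have "F (int a - 1) = (\<lambda>_. 0)"
      by (auto simp: F_def a_def hrow_def hom_ones_def)
    moreover obtain c where "\<And>u. det (?M u) = (\<Sum>j<k. u j * c j)"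
      using det_row_expand[OF assms(1), of G] by blast
    ultimately show ?thesis by simp
  next
    case (Suc t')
    show ?thesis
    proof (rule det_identical_rows[of _ k t t'])
      show "row (?M (F (int a - 1))) t = row (?M (F (int a - 1))) t'"
        using assms(1) Suc by (intro eq_vecI) (auto simp: F_def G_def a_def hrow_Suc)
    qed (use assms(1) Suc in auto)
  qed
  finally show ?thesis unfolding a_def diff_zero .
qed

lemma mixed_det_step:
  assumes "t < k" "mono_on {..<k} p"
  shows "(\<Sum>r\<in>below (Suc t) p. mixed_det k x p q (Suc t) r) = (\<Sum>r\<in>below t p. mixed_det k x p q t r)"
proof -
  have "(\<Sum>r\<in>below (Suc t) p. mixed_det k x p q (Suc t) r)
    = (\<Sum>(r, s)\<in>(SIGMA r:below t p. {(if t = 0 then 0 else r (t - 1))..p t}).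
         mixed_det k x p q (Suc t) (r(t := s)))"
    by (subst sum.reindex_bij_betw[OF below_Suc_bij, symmetric]) (simp add: case_prod_unfold)
  also have "\<dots> = (\<Sum>r\<in>below t p. \<Sum>s = (if t = 0 then 0 else r (t - 1))..p t.
         mixed_det k x p q (Suc t) (r(t := s)))"
    by (subst sum.Sigma) (auto simp: finite_below)
  also have "\<dots> = (\<Sum>r\<in>below t p. mixed_det k x p q t r)"
  proof (intro sum.cong mixed_det_row_sum assms refl)
    fix r assume r: "r \<in> below t p"
    show "(if t = 0 then 0 else r (t - 1)) \<le> p t"
    proof (cases "t = 0")
      case False
      then have "r (t - 1) \<le> p (t - 1)" using r by (auto simp: below_def)
      also have "\<dots> \<le> p t" using assms False by (intro mono_onD[OF assms(2)]) auto
      finally show ?thesis using False by simp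
    qed simp
  qed
  finally show ?thesis .
qed

text \<open>One step of a multichain: the sum ranges over the next up-set \<open>r\<close>. The sums
  over \<open>below t p\<close> agree for all \<open>t \<le> k\<close>, with the left side at
  \<open>t = 0\<close> and the right side at \<open>t = k\<close>.\<close>

lemma skew_det_add_one:
  assumes "mono_on {..<k} p"
  shows "skew_det k (x + 1) p q = (\<Sum>r\<in>below k p. skew_det k x r q)"
proof -
  have "t \<le> k \<Longrightarrow> (\<Sum>r\<in>below t p. mixed_det k x p q t r) = mixed_det k x p q 0 (\<lambda>_. undefined)" for t
    using assms by (induction t) (auto simp: below_0 mixed_det_step)
  moreover have "mixed_det k x p q k r = skew_det k x r q" for r
    unfolding mixed_det_def skew_det_def by (intro arg_cong[where f = det] eq_matI) auto
  moreover have "mixed_det k x p q 0 r = skew_det k (x + 1) p q" for r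
    unfolding mixed_det_def skew_det_def by (intro arg_cong[where f = det] eq_matI) auto
  ultimately show ?thesis by (metis (no_types, lifting) le_refl sum.cong)
qed

subsection \<open>The polynomial of a skew shape and its coefficients\<close>

lemma poly_pochhammer: "poly (pochhammer p n) x = pochhammer (poly p x) n"
  for p :: "'a :: comm_ring_1 poly"
  by (induction n) (auto simp: pochhammer_Suc)

definition hom_poly :: "int \<Rightarrow> int \<Rightarrow> rat poly" where
  "hom_poly a d = (if a < 0 then 0 else smult (1 / fact (nat a)) (pochhammer [:of_int d, 1:] (nat a)))"

lemma poly_hom_poly: "poly (hom_poly a d) x = hom_ones a (x + of_int d)"
  by (simp add: hom_poly_def hom_ones_def poly_pochhammer add.commute)

text \<open>The polynomial \<Omega> of the overview, formed over the polynomial ring so that its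
  coefficients can be inspected.\<close>

definition skew_poly :: "nat \<Rightarrow> (nat \<Rightarrow> nat) \<Rightarrow> (nat \<Rightarrow> nat) \<Rightarrow> rat poly" where
  "skew_poly k p q = det (mat k k (\<lambda>(i, j).
     hom_poly (int (p i) - int (q j) + int i - int j) (int j - int i)))"

lemma poly_eval_hom: "comm_ring_hom (\<lambda>p :: 'a :: comm_ring_1 poly. poly p x)"
  by unfold_locales auto

lemma poly_det:
  assumes "A \<in> carrier_mat n n"
  shows "poly (det A) x = det (mat n n (\<lambda>(i, j). poly (A $$ (i, j)) x))"
proof -
  interpret comm_ring_hom "\<lambda>p :: 'a poly. poly p x" by (rule poly_eval_hom)
  have "map_mat (\<lambda>p. poly p x) A = mat n n (\<lambda>(i, j). poly (A $$ (i, j)) x)"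
    using assms by (intro eq_matI) auto
  then show ?thesis using hom_det[of A] by simp
qed

lemma poly_skew_poly: "poly (skew_poly k p q) x = skew_det k x p q"
  unfolding skew_poly_def
  by (subst poly_det[where n = k])
     (auto simp: skew_det_def poly_hom_poly hrow_def intro!: arg_cong[where f = det] eq_matI)

section \<open>Constant and linear coefficients of the shape polynomials\<close>

lemma coeff_0_mult: "coeff (f * g) 0 = coeff f 0 * coeff g 0"
  for f g :: "'a :: comm_semiring_1 poly"
  by (simp add: coeff_mult)

lemma coeff_1_mult: "coeff (f * g) 1 = coeff f 0 * coeff g 1 + coeff f 1 * coeff g 0"
  for f g :: "'a :: comm_semiring_1 poly"
  by (simp add: coeff_mult)

text \<open>The product is \<open>(X - d) ... (X - 1) X (X + 1) ... (X + b - 1)\<close>. As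
  \<open>b \<ge> 1\<close>, the factor \<open>X\<close> occurs, and the linear coefficient is the
  product of the constant terms of the other factors.\<close>

lemma pochhammer_linear_coeffs:
  fixes d b :: nat
  assumes "b \<ge> 1"
  defines "P \<equiv> pochhammer [:- of_nat d, 1 :: rat:] (d + b)"
  shows "coeff P 0 = 0" "coeff P 1 = (- 1) ^ d * fact d * fact (b - 1)"
proof -
  obtain c where c: "b = Suc c" using assms by (cases b) auto
  have z: "[:- of_nat d, 1 :: rat:] + of_nat d = [:0, 1:]"
    by (simp add: of_nat_poly)
  have P: "P = pochhammer [:- of_nat d, 1:] d * ([:0, 1:] * pochhammer ([:0, 1:] + 1) c)"
    unfolding P_def c by (subst pochhammer_product'[of _ d]) (simp only: z pochhammer_rec)
  have "coeff (pochhammer [:- of_nat d, 1 :: rat:] d) 0 = pochhammer (- of_nat d) d"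
    by (simp add: poly_0_coeff_0[symmetric] poly_pochhammer)
  moreover have "coeff (pochhammer ([:0, 1 :: rat:] + 1) c) 0 = fact c"
    by (simp add: poly_0_coeff_0[symmetric] poly_pochhammer pochhammer_fact)
  ultimately show "coeff P 0 = 0" "coeff P 1 = (- 1) ^ d * fact d * fact (b - 1)"
    by (auto simp: P c coeff_0_mult coeff_1_mult[unfolded One_nat_def] pochhammer_same)
qed

text \<open>With \<open>d = i - j\<close> and \<open>b = u - v\<close> the entry is the product in
  \<open>pochhammer_linear_coeffs\<close> divided by \<open>(d + b)!\<close>. The sign will cancel
  against that of a cofactor.\<close>

lemma hom_poly_lower:
  fixes i j :: nat and u v :: nat
  assumes "j \<le> i" "v < u"
  defines "H \<equiv> hom_poly (int u - int v + int i - int j) (int j - int i)"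
  shows "coeff H 0 = 0" "(- 1) ^ (i - j) * coeff H 1 \<ge> 0"
proof -
  have a: "int u - int v + int i - int j = int (i - j + (u - v))" "int j - int i = - int (i - j)"
    using assms by auto
  have H: "H = smult (1 / fact (i - j + (u - v))) (pochhammer [:- of_nat (i - j), 1:] (i - j + (u - v)))"
    unfolding H_def hom_poly_def a by (auto simp: nat_add_distrib simp del: of_nat_diff)
  note c = pochhammer_linear_coeffs[of "u - v" "i - j"]
  show "coeff H 0 = 0" using c(1) assms(2) unfolding H by simp
  have "(- 1) ^ (i - j) * coeff H 1
      = fact (i - j) * fact (u - v - 1) / fact (i - j + (u - v))"
    using c(2) assms(2) unfolding H by (simp add: power_mult_distrib[symmetric] flip: power_add mult.assoc)
  then show "(- 1) ^ (i - j) * coeff H 1 \<ge> 0" by simp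
qed

text \<open>At 0 the entry is a complete homogeneous polynomial evaluated at a single one, hence
  1.\<close>

lemma hom_poly_superdiagonal:
  assumes "v < u"
  shows "coeff (hom_poly (int u - int v + int i - int (Suc i)) (int (Suc i) - int i)) 0 = 1"
proof -
  have "int u - int v + int i - int (Suc i) = int (u - v - 1)" "int (Suc i) - int i = 1"
    using assms by auto
  then show ?thesis
    by (simp add: poly_0_coeff_0[symmetric] poly_hom_poly hom_ones_def flip: pochhammer_fact)
qed

lemma det_zero_row:
  fixes A :: "'a :: comm_ring_1 mat"
  assumes "A \<in> carrier_mat n n" "i < n" "\<And>j. j < n \<Longrightarrow> A $$ (i, j) = 0"
  shows "det A = 0"
  using laplace_expansion_row[OF assms(1, 2)] assms(3) by simp

text \<open>For a connected shape, setting the variable to \<open>0\<close> makes the matrix strictly upper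
  triangular with ones above the diagonal, so that only the bottom left entry contributes to the
  linear coefficient.\<close>

lemma skew_poly_connected:
  assumes k: "k \<ge> 1" and p: "mono_on {..<k} p"
    and diag: "\<And>i. i < k \<Longrightarrow> q i < p i" and conn: "\<And>i. Suc i < k \<Longrightarrow> q (Suc i) < p i"
  shows "coeff (skew_poly k p q) 0 = 0" "coeff (skew_poly k p q) 1 \<ge> 0"
proof -
  let ?H = "\<lambda>i j. hom_poly (int (p i) - int (q j) + int i - int j) (int j - int i)"
  define M where "M = mat k k (\<lambda>(i, j). ?H i j)"
  have M: "M \<in> carrier_mat k k" by (simp add: M_def)
  have gt: "q j < p i" if "j \<le> i" "i < k" for i j
    using diag[of j] mono_onD[OF p, of j i] that by auto
  have exp: "skew_poly k p q = (\<Sum>i<k. ?H i 0 * cofactor M i 0)"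
    using laplace_expansion_column[OF M, of 0] k by (simp add: skew_poly_def M_def)
  have col0: "coeff (?H i 0) 0 = 0" if "i < k" for i
    using hom_poly_lower(1)[of 0 i "q 0" "p i"] gt[of 0 i] that by simp
  show "coeff (skew_poly k p q) 0 = 0"
    by (simp add: exp coeff_sum coeff_0_mult col0 del: of_nat_0)
  define D where "D = (\<lambda>i. mat (k - 1) (k - 1) (\<lambda>(i', j'). coeff (?H (if i' < i then i' else Suc i') (Suc j')) 0))"
  have cof: "coeff (cofactor M i 0) 0 = (- 1) ^ i * det (D i)" if "i < k" for i
  proof -
    have "poly (cofactor M i 0) 0 = (- 1) ^ i * poly (det (mat_delete M i 0)) 0"
      by (simp add: cofactor_def)
    also have "poly (det (mat_delete M i 0)) 0 = det (D i)"
      using M that unfolding D_def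
      by (subst poly_det[where n = "k - 1"])
         (auto simp: mat_delete_def M_def poly_0_coeff_0 intro!: arg_cong[where f = det] eq_matI)
    finally show ?thesis by (simp add: poly_0_coeff_0)
  qed
  \<comment> \<open>Deleting a row other than the last keeps row \<open>k - 1\<close>, whose entries
    all vanish at 0.\<close>
  have D0: "det (D i) = 0" if "i < k - 1" for i
  proof (rule det_zero_row[of _ "k - 1" "k - 2"])
    fix j assume j: "j < k - 1"
    have "Suc (k - 2) = k - 1" using that by simp
    then show "D i $$ (k - 2, j) = 0"
      using that j hom_poly_lower(1)[of "Suc j" "k - 1" "q (Suc j)" "p (k - 1)"] gt[of "Suc j" "k - 1"]
      by (auto simp: D_def)
  qed (use that in \<open>auto simp: D_def\<close>)
  have D1: "det (D (k - 1)) = 1"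
  proof -
    have "upper_triangular (D (k - 1))"
      unfolding upper_triangular_def
    proof (intro allI impI)
      fix i j assume ij: "i < dim_row (D (k - 1))" "j < i"
      then show "D (k - 1) $$ (i, j) = 0"
        using hom_poly_lower(1)[of "Suc j" i "q (Suc j)" "p i"] gt[of "Suc j" i] by (auto simp: D_def)
    qed
    then have "det (D (k - 1)) = prod_list (diag_mat (D (k - 1)))"
      by (rule det_upper_triangular[where n = "k - 1"]) (simp add: D_def)
    also have "diag_mat (D (k - 1)) = map (\<lambda>_. 1) [0..<k - 1]"
      using hom_poly_superdiagonal conn by (auto simp: diag_mat_def D_def intro!: map_cong)
    finally show ?thesis by (simp add: map_replicate_const)
  qed
  have "coeff (skew_poly k p q) 1 = (\<Sum>i<k. coeff (?H i 0) 1 * coeff (cofactor M i 0) 0)"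
    unfolding exp coeff_sum by (intro sum.cong refl) (simp only: coeff_1_mult col0 lessThan_iff mult_zero_left add_0)
  also have "\<dots> = (\<Sum>i\<in>{k - 1}. coeff (?H i 0) 1 * coeff (cofactor M i 0) 0)"
  proof (rule sum.mono_neutral_right)
    show "\<forall>i\<in>{..<k} - {k - 1}. coeff (?H i 0) 1 * coeff (cofactor M i 0) 0 = 0"
    proof
      fix i assume "i \<in> {..<k} - {k - 1}"
      then have "i < k" "i < k - 1" by auto
      then show "coeff (?H i 0) 1 * coeff (cofactor M i 0) 0 = 0"
        using cof[of i] D0[of i] by simp
    qed
  qed (use k in auto)
  also have "\<dots> = (- 1) ^ (k - 1) * coeff (?H (k - 1) 0) 1"
    using cof[of "k - 1"] D1 k by simp
  \<comment> \<open>The cofactor sign \<open>(- 1) ^ (k - 1)\<close> cancels the sign of the linear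
    coefficient of the bottom left entry.\<close>
  finally show "coeff (skew_poly k p q) 1 \<ge> 0"
    using hom_poly_lower(2)[of 0 "k - 1" "q 0" "p (k - 1)"] gt[of 0 "k - 1"] k by simp
qed

text \<open>Across the gap the degrees \<open>p i - q j + i - j\<close> are negative, so the upper
  right block is zero. Positions enter only through \<open>i - j\<close>, so the lower right block
  is again the matrix of a shape.\<close>

lemma skew_poly_split:
  assumes p: "mono_on {..<k + n} p" and q: "mono_on {..<k + n} q"
    and kn: "0 < k" "0 < n" and gap: "p (k - 1) \<le> q k"
  shows "skew_poly (k + n) p q = skew_poly k p q * skew_poly n (\<lambda>i. p (k + i)) (\<lambda>i. q (k + i))"
proof -
  let ?H = "\<lambda>i j. hom_poly (int (p i) - int (q j) + int i - int j) (int j - int i)"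
  let ?A = "mat k k (\<lambda>(i, j). ?H i j)"
  let ?C = "mat n k (\<lambda>(i, j). ?H (k + i) j)"
  let ?D = "mat n n (\<lambda>(i, j). hom_poly (int (p (k + i)) - int (q (k + j)) + int i - int j) (int j - int i))"
  have zero: "?H i j = 0" if "i < k" "k \<le> j" "j < k + n" for i j
  proof -
    have "p i \<le> p (k - 1)" using that kn by (intro mono_onD[OF p]) auto
    moreover have "q k \<le> q j" using that kn by (intro mono_onD[OF q]) auto
    ultimately show ?thesis using that gap by (simp add: hom_poly_def)
  qed
  have "mat (k + n) (k + n) (\<lambda>(i, j). ?H i j) = four_block_mat ?A (0\<^sub>m k n) ?C ?D"
  proof (rule eq_matI)
    fix i j assume "i < dim_row (four_block_mat ?A (0\<^sub>m k n) ?C ?D)"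
      "j < dim_col (four_block_mat ?A (0\<^sub>m k n) ?C ?D)"
    then have ij: "i < k + n" "j < k + n" by auto
    show "mat (k + n) (k + n) (\<lambda>(i, j). ?H i j) $$ (i, j) = four_block_mat ?A (0\<^sub>m k n) ?C ?D $$ (i, j)"
    proof (cases "i < k \<and> k \<le> j")
      case True
      moreover from this have "j - k < n" using ij by linarith
      ultimately show ?thesis using ij zero[of i j] by simp
    next
      case False
      then show ?thesis using ij by (auto simp: not_less of_nat_diff algebra_simps)
    qed
  qed auto
  then show ?thesis
    unfolding skew_poly_def
    by (simp only:) (rule det_four_block_mat_upper_right_zero, auto)
qed

text \<open>The constant coefficient counts multichains of length 0. Strong induction on
  \<open>k\<close>: at a gap the polynomial factors, and the linear coefficient of the product is a
  sum of products of nonnegative numbers; without a gap the shape is connected.\<close>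

lemma skew_poly_coeff_01:
  assumes "mono_on {..<k} p" "mono_on {..<k} q"
  shows "coeff (skew_poly k p q) 0 = (if \<forall>i<k. p i = q i then 1 else 0)
    \<and> coeff (skew_poly k p q) 1 \<ge> 0"
  using assms
proof (induction k arbitrary: p q rule: less_induct)
  case (less k)
  \<comment> \<open>A gap compares consecutive rows, so a single row has to be treated
    apart.\<close>
  consider "k = 0" | i where "0 < i" "i < k" "p (i - 1) \<le> q i" | "k = 1" "p 0 \<le> q 0"
    | "k \<ge> 1" "\<And>i. Suc i < k \<Longrightarrow> q (Suc i) < p i" "k = 1 \<Longrightarrow> q 0 < p 0"
  proof (cases "k = 0 \<or> (\<exists>i. 0 < i \<and> i < k \<and> p (i - 1) \<le> q i) \<or> k = 1 \<and> p 0 \<le> q 0")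
    case False
    then have "q (Suc i) < p i" if "Suc i < k" for i
      using that by (auto dest: spec[of _ "Suc i"])
    then show ?thesis using that(4) False by auto
  qed (use that in blast)
  then show ?case
  proof cases
    case 1
    then show ?thesis by (simp add: skew_poly_def)
  next
    case (2 i)
    define n where "n = k - i"
    have k: "k = i + n" and n: "n > 0" "n < k" using 2 by (auto simp: n_def)
    let ?p = "\<lambda>l. p (i + l)" and ?q = "\<lambda>l. q (i + l)"
    have eq: "skew_poly k p q = skew_poly i p q * skew_poly n ?p ?q"
      using skew_poly_split[of i n p q] less.prems 2 n unfolding k by simp
    have m: "mono_on {..<i} p" "mono_on {..<i} q" "mono_on {..<n} ?p" "mono_on {..<n} ?q"
      using less.prems unfolding k by (auto simp: mono_on_def)
    have "{..<k} = {..<i} \<union> (\<lambda>l. i + l) ` {..<n}"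
    proof (intro equalityI subsetI)
      fix l assume "l \<in> {..<k}"
      then show "l \<in> {..<i} \<union> (\<lambda>l. i + l) ` {..<n}"
        unfolding k by (cases "l < i") (auto intro!: image_eqI[of _ _ "l - i"])
    qed (auto simp: k)
    then have "(\<forall>l\<in>{..<k}. p l = q l) \<longleftrightarrow> (\<forall>l\<in>{..<i}. p l = q l) \<and> (\<forall>l\<in>{..<n}. ?p l = ?q l)"
      by (auto simp: ball_Un)
    then have "(\<forall>l<k. p l = q l) \<longleftrightarrow> (\<forall>l<i. p l = q l) \<and> (\<forall>l<n. ?p l = ?q l)"
      by (simp add: Ball_def)
    then show ?thesis
      using less.IH[OF 2(2) m(1, 2)] less.IH[OF n(2) m(3, 4)]
      unfolding eq coeff_0_mult coeff_1_mult by auto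
  next
    case 3
    have "skew_poly k p q = hom_poly (int (p 0) - int (q 0)) 0"
      unfolding skew_poly_def 3(1) by (subst det_single) auto
    then show ?thesis using 3 by (auto simp: hom_poly_def)
  next
    case 4
    \<comment> \<open>Here \<open>q i \<le> q (i + 1) < p i\<close>, and in the last of several rows
      \<open>q i < p (i - 1) \<le> p i\<close>.\<close>
    have diag: "q i < p i" if "i < k" for i
    proof (cases "Suc i < k")
      case True
      then have "q i \<le> q (Suc i)" using less.prems(2) by (auto intro: mono_onD)
      then show ?thesis using 4(2)[OF True] by simp
    next
      case False
      show ?thesis
      proof (cases i)
        case 0
        then show ?thesis using False that 4 by (cases "k = 1") auto
      next
        case (Suc i')
        then have "p i' \<le> p i" using less.prems(1) that by (auto intro: mono_onD)
        then show ?thesis using 4(2)[of i'] Suc that by simp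
      qed
    qed
    have "\<not> (\<forall>i<k. p i = q i)" using diag[of 0] 4(1) by (auto intro!: exI[of _ 0])
    then show ?thesis
      using skew_poly_connected[OF 4(1) less.prems(1), of q] diag 4(2) by simp
  qed
qed

section \<open>Multiplicativity in the variable and nonnegativity of all coefficients\<close>

definition mono_seqs :: "nat \<Rightarrow> (nat \<Rightarrow> nat) set" where
  "mono_seqs k = {p \<in> {..<k} \<rightarrow>\<^sub>E UNIV. mono_on {..<k} p}"

lemma below_iff: "r \<in> below k p \<longleftrightarrow> r \<in> mono_seqs k \<and> (\<forall>i<k. r i \<le> p i)"
  by (auto simp: below_def mono_seqs_def)

lemma mono_seqs_ext: "p \<in> mono_seqs k \<Longrightarrow> q \<in> mono_seqs k \<Longrightarrow> (\<forall>i<k. p i = q i) \<longleftrightarrow> p = q"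
  using PiE_ext[where x = p and y = q and k = "{..<k}"] by (auto simp: mono_seqs_def)

lemma poly_skew_poly_0:
  assumes "p \<in> mono_seqs k" "q \<in> mono_seqs k"
  shows "poly (skew_poly k p q) 0 = (if p = q then 1 else 0)"
  using skew_poly_coeff_01[of k p q] assms mono_seqs_ext[OF assms]
  by (simp add: poly_0_coeff_0 mono_seqs_def)

lemma poly_skew_poly_add_one:
  assumes "p \<in> mono_seqs k"
  shows "poly (skew_poly k p q) (x + 1) = (\<Sum>r\<in>below k p. poly (skew_poly k r q) x)"
  using skew_det_add_one[of k p x q] assms by (simp add: poly_skew_poly mono_seqs_def)

text \<open>The matrix identity \<open>\<Omega>(n + y) = \<Omega>(n) \<Omega>(y)\<close>, indexed by
  the finite set of shapes below a fixed \<open>P\<close>. At \<open>n = 0\<close> the first factor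
  is the identity matrix; the induction step uses \<open>poly_skew_poly_add_one\<close> on both
  sides.\<close>

lemma skew_poly_convolution_nat:
  assumes "p \<in> below k P" "q \<in> mono_seqs k"
  shows "poly (skew_poly k p q) (of_nat n + y)
    = (\<Sum>r\<in>below k P. poly (skew_poly k p r) (of_nat n) * poly (skew_poly k r q) y)"
  using assms(1)
proof (induction n arbitrary: p)
  case 0
  have "(\<Sum>r\<in>below k P. poly (skew_poly k p r) (of_nat 0) * poly (skew_poly k r q) y)
    = (\<Sum>r\<in>below k P. if p = r then poly (skew_poly k r q) y else 0)"
    using 0 by (intro sum.cong) (auto simp: poly_skew_poly_0 below_iff)
  then show ?case using 0 by (simp add: finite_below)
next
  case (Suc n)
  have p: "p \<in> mono_seqs k" using Suc.prems by (simp add: below_iff)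
  have sub: "s \<in> below k P" if "s \<in> below k p" for s
    using Suc.prems that by (meson below_iff order_trans)
  have "poly (skew_poly k p q) (of_nat (Suc n) + y) = poly (skew_poly k p q) ((of_nat n + y) + 1)"
    by (simp add: algebra_simps)
  also have "\<dots> = (\<Sum>s\<in>below k p. \<Sum>r\<in>below k P. poly (skew_poly k s r) (of_nat n) * poly (skew_poly k r q) y)"
    unfolding poly_skew_poly_add_one[OF p] by (intro sum.cong refl Suc.IH sub)
  also have "\<dots> = (\<Sum>r\<in>below k P. (\<Sum>s\<in>below k p. poly (skew_poly k s r) (of_nat n)) * poly (skew_poly k r q) y)"
    by (subst sum.swap) (simp add: sum_distrib_right)
  also have "\<dots> = (\<Sum>r\<in>below k P. poly (skew_poly k p r) (of_nat n + 1) * poly (skew_poly k r q) y)"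
    unfolding poly_skew_poly_add_one[OF p] ..
  finally show ?case by (simp add: add.commute)
qed

lemma poly_eqI_nat:
  fixes f g :: "'a :: field_char_0 poly"
  assumes "\<And>n. poly f (of_nat n) = poly g (of_nat n)"
  shows "f = g"
proof (rule ccontr)
  assume "f \<noteq> g"
  then have "finite {x. poly (f - g) x = 0}" by (intro poly_roots_finite) simp
  moreover have "range of_nat \<subseteq> {x. poly (f - g) x = 0}" using assms by auto
  ultimately have "finite (range of_nat :: 'a set)" by (rule finite_subset[rotated])
  moreover have "infinite (range of_nat :: 'a set)"
    by (intro range_inj_infinite inj_onI) simp
  ultimately show False by contradiction
qed

text \<open>This differentiates \<open>\<Omega>(X + y) = \<Omega>(X) \<Omega>(y)\<close> at
  \<open>X = 0\<close>. For fixed \<open>y\<close> both sides are polynomials in \<open>X\<close>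
  that agree at all naturals, hence they are equal.\<close>

lemma skew_poly_deriv:
  assumes "p \<in> below k P" "q \<in> mono_seqs k"
  shows "pderiv (skew_poly k p q) = (\<Sum>r\<in>below k P. smult (coeff (skew_poly k p r) 1) (skew_poly k r q))"
proof (rule poly_ext)
  fix y :: rat
  have eq: "pcompose (skew_poly k p q) [:y, 1:]
      = (\<Sum>r\<in>below k P. smult (poly (skew_poly k r q) y) (skew_poly k p r))"
    by (rule poly_eqI_nat)
       (use skew_poly_convolution_nat[OF assms] in \<open>simp add: poly_pcompose poly_sum ac_simps\<close>)
  have "poly (pderiv (skew_poly k p q)) y = poly (pderiv (pcompose (skew_poly k p q) [:y, 1:])) 0"
    by (simp add: pderiv_pcompose poly_pcompose pderiv_pCons)
  also have "\<dots> = (\<Sum>r\<in>below k P. poly (skew_poly k r q) y * coeff (skew_poly k p r) 1)"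
    unfolding poly_0_coeff_0 coeff_pderiv eq by (simp add: coeff_sum)
  finally show "poly (pderiv (skew_poly k p q)) y
      = poly (\<Sum>r\<in>below k P. smult (coeff (skew_poly k p r) 1) (skew_poly k r q)) y"
    by (simp add: poly_sum mult.commute)
qed

text \<open>By \<open>\<Omega>' = L \<Omega>\<close>, the coefficient of degree \<open>Suc n\<close>
  times \<open>Suc n\<close> is a sum of products of linear coefficients with coefficients of degree
  \<open>n\<close>, all nonnegative.\<close>

lemma skew_poly_coeff_nonneg:
  assumes "p \<in> mono_seqs k" "q \<in> mono_seqs k"
  shows "coeff (skew_poly k p q) n \<ge> 0"
  using assms(1)
proof (induction n arbitrary: p)
  case 0
  then show ?case using skew_poly_coeff_01[of k p q] assms(2) by (simp add: mono_seqs_def)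
next
  case (Suc n)
  have "of_nat (Suc n) * coeff (skew_poly k p q) (Suc n) = coeff (pderiv (skew_poly k p q)) n"
    by (simp add: coeff_pderiv)
  also have "\<dots> = (\<Sum>r\<in>below k p. coeff (skew_poly k p r) 1 * coeff (skew_poly k r q) n)"
    using Suc.prems assms(2) by (subst skew_poly_deriv[of p k p]) (auto simp: below_iff coeff_sum)
  also have "\<dots> \<ge> 0"
    using Suc skew_poly_coeff_01 by (intro sum_nonneg mult_nonneg_nonneg) (auto simp: below_iff mono_seqs_def)
  finally show ?case by (simp add: zero_le_mult_iff del: of_nat_Suc)
qed

subsection \<open>Multivariate polynomials with nonnegative coefficients\<close>

definition eval_mono :: "(nat \<Rightarrow>\<^sub>0 nat) \<Rightarrow> (nat \<Rightarrow> rat) \<Rightarrow> rat" where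
  "eval_mono t v = (\<Prod>i\<in>Poly_Mapping.keys t. v i ^ Poly_Mapping.lookup t i)"

lemma eval_mono_superset:
  assumes "finite S" "Poly_Mapping.keys t \<subseteq> S"
  shows "eval_mono t v = (\<Prod>i\<in>S. v i ^ Poly_Mapping.lookup t i)"
  unfolding eval_mono_def using assms
  by (intro prod.mono_neutral_left) (auto simp: in_keys_iff)

lemma eval_mono_add: "eval_mono (s + t) v = eval_mono s v * eval_mono t v"
proof -
  let ?S = "Poly_Mapping.keys s \<union> Poly_Mapping.keys t"
  have "eval_mono r v = (\<Prod>i\<in>?S. v i ^ Poly_Mapping.lookup r i)" if "r \<in> {s, t, s + t}" for r
    using that Poly_Mapping.keys_add[of s t] by (intro eval_mono_superset) auto
  then show ?thesis by (simp add: lookup_add power_add prod.distrib)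
qed

lemma eval_mono_single: "eval_mono (Poly_Mapping.single i n) v = v i ^ n"
  by (subst eval_mono_superset[of "{i}"]) auto

lemma eval_mpoly_superset:
  assumes "finite S" "Poly_Mapping.keys p \<subseteq> S"
  shows "eval_mpoly p v = (\<Sum>t\<in>S. Poly_Mapping.lookup p t * eval_mono t v)"
  unfolding eval_mpoly_def eval_mono_def[symmetric] using assms
  by (intro sum.mono_neutral_left) (auto simp: in_keys_iff)

lemma eval_mpoly_add: "eval_mpoly (p + q) v = eval_mpoly p v + eval_mpoly q v"
proof -
  let ?S = "Poly_Mapping.keys p \<union> Poly_Mapping.keys q"
  have "eval_mpoly r v = (\<Sum>t\<in>?S. Poly_Mapping.lookup r t * eval_mono t v)" if "r \<in> {p, q, p + q}" for r
    using that Poly_Mapping.keys_add[of p q] by (intro eval_mpoly_superset) auto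
  then show ?thesis by (simp add: lookup_add distrib_right sum.distrib)
qed

text \<open>A predicate on functions rather than on \<open>rat_mpoly\<close>, so that closure under
  products needs only the evaluation of monomials.\<close>

definition nonneg_poly_fun :: "nat \<Rightarrow> ((nat \<Rightarrow> rat) \<Rightarrow> rat) \<Rightarrow> bool" where
  "nonneg_poly_fun k f \<longleftrightarrow>
     (\<exists>p\<in>rat_polys k. (\<forall>t. Poly_Mapping.lookup p t \<ge> 0) \<and> (\<forall>v. f v = eval_mpoly p v))"

lemma nonneg_poly_fun_mono:
  assumes "c \<ge> 0" "Poly_Mapping.keys t \<subseteq> {1..k}"
  shows "nonneg_poly_fun k (\<lambda>v. c * eval_mono t v)"
  unfolding nonneg_poly_fun_def
proof (intro bexI[of _ "Poly_Mapping.single t c"] conjI allI)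
  show "c * eval_mono t v = eval_mpoly (Poly_Mapping.single t c) v" for v
    by (subst eval_mpoly_superset[of "{t}"]) auto
qed (use assms in \<open>auto simp: rat_polys_def lookup_single when_def\<close>)

lemma nonneg_poly_fun_0: "nonneg_poly_fun k (\<lambda>_. 0)"
  using nonneg_poly_fun_mono[of 0 0 k] by simp

lemma nonneg_poly_fun_1: "nonneg_poly_fun k (\<lambda>_. 1)"
  using nonneg_poly_fun_mono[of 1 0 k] by (simp add: eval_mono_def)

lemma nonneg_poly_fun_add:
  assumes "nonneg_poly_fun k f" "nonneg_poly_fun k g"
  shows "nonneg_poly_fun k (\<lambda>v. f v + g v)"
proof -
  from assms obtain p q where "p \<in> rat_polys k" "q \<in> rat_polys k"
    "\<forall>t. Poly_Mapping.lookup p t \<ge> 0" "\<forall>t. Poly_Mapping.lookup q t \<ge> 0"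
    "\<forall>v. f v = eval_mpoly p v" "\<forall>v. g v = eval_mpoly q v"
    unfolding nonneg_poly_fun_def by blast
  moreover from this have "p + q \<in> rat_polys k"
    using Poly_Mapping.keys_add[of p q] unfolding rat_polys_def by blast
  ultimately show ?thesis
    unfolding nonneg_poly_fun_def by (intro bexI[of _ "p + q"]) (auto simp: eval_mpoly_add lookup_add)
qed

lemma nonneg_poly_fun_sum:
  "(\<And>a. a \<in> A \<Longrightarrow> nonneg_poly_fun k (f a)) \<Longrightarrow> nonneg_poly_fun k (\<lambda>v. \<Sum>a\<in>A. f a v)"
  by (induction A rule: infinite_finite_induct) (auto intro: nonneg_poly_fun_0 nonneg_poly_fun_add)

lemma nonneg_poly_fun_mono_mult:
  assumes "nonneg_poly_fun k f" "c \<ge> 0" "Poly_Mapping.keys s \<subseteq> {1..k}"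
  shows "nonneg_poly_fun k (\<lambda>v. c * eval_mono s v * f v)"
proof -
  obtain p where p: "p \<in> rat_polys k" "\<And>t. Poly_Mapping.lookup p t \<ge> 0" "\<And>v. f v = eval_mpoly p v"
    using assms(1) unfolding nonneg_poly_fun_def by blast
  have "nonneg_poly_fun k
      (\<lambda>v. \<Sum>t\<in>Poly_Mapping.keys p. (c * Poly_Mapping.lookup p t) * eval_mono (s + t) v)"
  proof (intro nonneg_poly_fun_sum nonneg_poly_fun_mono)
    fix t assume "t \<in> Poly_Mapping.keys p"
    then show "Poly_Mapping.keys (s + t) \<subseteq> {1..k}"
      using p(1) assms(3) Poly_Mapping.keys_add[of s t] unfolding rat_polys_def by blast
  qed (use assms(2) p(2) in auto)
  then show ?thesis
    by (simp add: p(3) eval_mpoly_superset[OF _ order_refl] eval_mono_add sum_distrib_left mult_ac)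
qed

lemma nonneg_poly_fun_poly_mult:
  assumes "nonneg_poly_fun k f" "\<And>n. coeff g n \<ge> 0" "i \<in> {1..k}"
  shows "nonneg_poly_fun k (\<lambda>v. poly g (v i) * f v)"
proof -
  have "nonneg_poly_fun k
      (\<lambda>v. \<Sum>n\<le>degree g. coeff g n * eval_mono (Poly_Mapping.single i n) v * f v)"
    using assms by (intro nonneg_poly_fun_sum nonneg_poly_fun_mono_mult) auto
  then show ?thesis by (simp add: poly_altdef sum_distrib_right eval_mono_single)
qed

subsection \<open>Fillings of shapes\<close>

text \<open>Rows are numbered from \<open>1\<close>; row \<open>i\<close> consists of the last \<open>p (i - 1)\<close> of \<open>m\<close> cells.\<close>

definition cells :: "nat \<Rightarrow> nat \<Rightarrow> (nat \<Rightarrow> nat) \<Rightarrow> (nat \<times> nat) set" where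
  "cells k m p = {(i, j). i \<in> {1..k} \<and> j \<in> {1..m} \<and> m < j + p (i - 1)}"

text \<open>The sets of cells with entry at least \<open>s\<close> form the decreasing chain of
  up-sets. Entries start at 1, so a row with bound 0 must be empty.\<close>

definition fillings :: "(nat \<times> nat) set \<Rightarrow> (nat \<Rightarrow> nat) \<Rightarrow> (nat \<times> nat \<Rightarrow> nat) set" where
  "fillings F b = {f \<in> F \<rightarrow>\<^sub>E UNIV. (\<forall>c\<in>F. 1 \<le> f c \<and> f c \<le> b (fst c))
     \<and> (\<forall>c\<in>F. \<forall>d\<in>F. fst c \<le> fst d \<and> snd c \<le> snd d \<longrightarrow> f c \<le> f d)}"

lemma finite_cells: "finite (cells k m p)"
  by (rule finite_subset[of _ "{1..k} \<times> {1..m}"]) (auto simp: cells_def)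

lemma finite_fillings:
  assumes "finite F"
  shows "finite (fillings F b)"
proof (rule finite_subset)
  show "fillings F b \<subseteq> (\<Pi>\<^sub>E c\<in>F. {..b (fst c)})"
    by (auto simp: fillings_def PiE_def Pi_def)
qed (use assms in \<open>auto intro!: finite_PiE\<close>)

lemma fillings_empty: "fillings {} b = {\<lambda>_. undefined}"
  by (auto simp: fillings_def)

text \<open>Such a set is empty or an interval ending at \<open>m\<close>, hence determined by its
  size.\<close>

lemma upset_of_interval:
  fixes S :: "nat set"
  assumes "S \<subseteq> {1..m}" "\<And>i j. i \<in> S \<Longrightarrow> i \<le> j \<Longrightarrow> j \<le> m \<Longrightarrow> j \<in> S"
  shows "j \<in> S \<longleftrightarrow> j \<in> {1..m} \<and> m < j + card S"
proof (cases "S = {}")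
  case False
  have fin: "finite S" using assms(1) finite_subset by blast
  have S: "S = {Min S..m}"
  proof (intro equalityI subsetI)
    show "i \<in> {Min S..m}" if "i \<in> S" for i using that assms(1) Min_le[OF fin] by auto
    show "i \<in> S" if "i \<in> {Min S..m}" for i using that assms(2)[OF Min_in[OF fin False]] by auto
  qed
  have "Min S \<in> {1..m}" using assms(1) Min_in[OF fin False] by auto
  moreover have "card S = m + 1 - Min S" using arg_cong[OF S, of card] by simp
  moreover have "j \<in> S \<longleftrightarrow> Min S \<le> j \<and> j \<le> m" using S by (metis atLeastAtMost_iff)
  ultimately show ?thesis by auto
qed auto

lemma cells_subset_iff:
  assumes "\<And>i. i < k \<Longrightarrow> r i \<le> m"
  shows "cells k m r \<subseteq> cells k m p \<longleftrightarrow> (\<forall>i<k. r i \<le> p i)"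
proof
  assume sub: "cells k m r \<subseteq> cells k m p"
  show "\<forall>i<k. r i \<le> p i"
  proof (intro allI impI)
    fix i assume i: "i < k"
    show "r i \<le> p i"
    proof (cases "r i = 0")
      case False
      \<comment> \<open>The witness is the leftmost cell of this row of \<open>r\<close>.\<close>
      then have "(Suc i, Suc m - r i) \<in> cells k m r"
        using i assms[OF i] by (auto simp: cells_def)
      then have "(Suc i, Suc m - r i) \<in> cells k m p" using sub by blast
      then show ?thesis using assms[OF i] by (auto simp: cells_def)
    qed simp
  qed
next
  assume le: "\<forall>i<k. r i \<le> p i"
  show "cells k m r \<subseteq> cells k m p"
  proof
    fix c assume "c \<in> cells k m r"
    moreover from this have "r (fst c - 1) \<le> p (fst c - 1)" using le by (auto simp: cells_def)
    ultimately show "c \<in> cells k m p" by (auto simp: cells_def)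
  qed
qed

lemma cells_inj:
  assumes "r \<in> mono_seqs k" "s \<in> mono_seqs k" "\<And>i. i < k \<Longrightarrow> r i \<le> m" "\<And>i. i < k \<Longrightarrow> s i \<le> m"
    "cells k m r = cells k m s"
  shows "r = s"
proof -
  have "\<forall>i<k. r i = s i"
    using cells_subset_iff[of k r m s] cells_subset_iff[of k s m r] assms by (simp add: order_antisym)
  then show ?thesis using mono_seqs_ext assms by blast
qed

text \<open>Each row of \<open>G\<close> is closed to the right, so its size serves as the row
  length; closure along the columns makes these lengths increase with the row.\<close>

lemma upset_eq_cells:
  assumes p: "p \<in> mono_seqs k" "\<And>i. i < k \<Longrightarrow> p i \<le> m"
    and G: "G \<subseteq> cells k m p"
    and up: "\<And>c d. c \<in> G \<Longrightarrow> d \<in> cells k m p \<Longrightarrow> fst c \<le> fst d \<Longrightarrow> snd c \<le> snd d \<Longrightarrow> d \<in> G"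
  obtains r where "r \<in> below k p" "cells k m r = G"
proof -
  define S where "S = (\<lambda>i. {j. (Suc i, j) \<in> G})"
  define r where "r = restrict (\<lambda>i. card (S i)) {..<k}"
  have mono_p: "p i \<le> p j" if "i \<le> j" "j < k" for i j
    using p(1) that by (auto simp: mono_seqs_def intro: mono_onD)
  have S_sub: "S i \<subseteq> {1..m}" for i using G by (auto simp: S_def cells_def)
  have S_iff: "j \<in> S i \<longleftrightarrow> j \<in> {1..m} \<and> m < j + card (S i)" for i j
  proof (rule upset_of_interval[OF S_sub])
    fix a b assume ab: "a \<in> S i" "a \<le> b" "b \<le> m"
    then have "(Suc i, b) \<in> cells k m p" using G by (auto simp: S_def cells_def)
    then show "b \<in> S i" using up[of "(Suc i, a)" "(Suc i, b)"] ab by (auto simp: S_def)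
  qed
  have eq: "cells k m r = G"
  proof (intro Set.set_eqI)
    fix c :: "nat \<times> nat"
    obtain i j where c: "c = (i, j)" by (cases c)
    show "c \<in> cells k m r \<longleftrightarrow> c \<in> G"
    proof (cases "i \<in> {1..k}")
      case True
      then have "c \<in> G \<longleftrightarrow> j \<in> S (i - 1)" by (auto simp: c S_def)
      then show ?thesis using True by (auto simp: S_iff c cells_def r_def)
    next
      case False
      then show ?thesis using G by (auto simp: c cells_def)
    qed
  qed
  have rm: "r i \<le> m" if "i < k" for i
    using card_mono[OF _ S_sub[of i]] that by (simp add: r_def)
  have S_mono: "S i \<subseteq> S j" if "i \<le> j" "j < k" for i j
  proof
    fix a assume a: "a \<in> S i"
    then have "(Suc j, a) \<in> cells k m p"
      using G mono_p[OF that] that by (fastforce simp: S_def cells_def)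
    then show "a \<in> S j" using up[of "(Suc i, a)" "(Suc j, a)"] a that by (auto simp: S_def)
  qed
  have "r \<in> mono_seqs k"
    using finite_subset[OF S_sub] by (auto simp: mono_seqs_def r_def intro!: mono_onI card_mono dest: subsetD[OF S_mono, rotated 2])
  moreover have "\<forall>i<k. r i \<le> p i"
    using cells_subset_iff[of k r m p] rm eq G by simp
  ultimately show thesis using that eq by (simp add: below_iff)
qed

text \<open>The cells with entry at least \<open>2\<close> form a smaller shape.\<close>

lemma card_fillings_step:
  assumes p: "p \<in> mono_seqs k" "\<And>i. i < k \<Longrightarrow> p i \<le> m"
    and b: "\<And>c. c \<in> cells k m p \<Longrightarrow> 1 \<le> b (fst c)"
  shows "card (fillings (cells k m p) b)
    = (\<Sum>r\<in>below k p. card (fillings (cells k m r) (\<lambda>i. b i - 1)))"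
proof -
  let ?P = "cells k m p"
  let ?S = "SIGMA r:below k p. fillings (cells k m r) (\<lambda>i. b i - 1)"
  \<comment> \<open>This undoes the removal of the lowest level: entries of \<open>g\<close> go up
    by one and the remaining cells receive 1.\<close>
  define \<phi> where "\<phi> = (\<lambda>(r, g). restrict (\<lambda>c. if c \<in> cells k m r then Suc (g c) else 1) ?P)"
  have le: "r i \<le> m" if "r \<in> below k p" "i < k" for r i
    using that p(2)[of i] by (auto simp: below_iff intro: order_trans)
  have sub: "cells k m r \<subseteq> ?P" if "r \<in> below k p" for r
    using that cells_subset_iff[of k r m p] le by (auto simp: below_iff)
  have upper: "d \<in> cells k m r"
    if "r \<in> below k p" "c \<in> cells k m r" "d \<in> ?P" "fst c \<le> fst d" "snd c \<le> snd d" for r c d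
  proof -
    have "r (fst c - 1) \<le> r (fst d - 1)"
      using that by (intro mono_onD[of "{..<k}" r]) (auto simp: below_def cells_def)
    then show ?thesis using that by (auto simp: cells_def)
  qed
  \<comment> \<open>Entries of \<open>g\<close> are at least 1, so \<open>r\<close> can be read off
    from the image; injectivity rests on this.\<close>
  have level: "cells k m r = {c \<in> ?P. 2 \<le> \<phi> (r, g) c}"
    if "r \<in> below k p" "g \<in> fillings (cells k m r) (\<lambda>i. b i - 1)" for r g
    using that sub[OF that(1)] by (force simp: \<phi>_def fillings_def)
  have "bij_betw \<phi> ?S (fillings ?P b)"
    unfolding bij_betw_def
  proof (intro conjI inj_onI equalityI subsetI)
    fix x y assume xy: "x \<in> ?S" "y \<in> ?S" "\<phi> x = \<phi> y"
    obtain r g s h where x: "x = (r, g)" and y: "y = (s, h)" by (cases x, cases y)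
    have rs: "r \<in> below k p" "s \<in> below k p" using xy by (auto simp: x y)
    have "cells k m r = cells k m s"
      using level[of r g] level[of s h] xy by (auto simp: x y)
    then have "r = s" using cells_inj[of r k s m] rs le by (auto simp: below_iff)
    moreover have "g = h"
    proof (rule PiE_ext)
      show "g \<in> cells k m r \<rightarrow>\<^sub>E UNIV" "h \<in> cells k m r \<rightarrow>\<^sub>E UNIV"
        using xy \<open>r = s\<close> by (auto simp: x y fillings_def)
      show "g c = h c" if "c \<in> cells k m r" for c
        using fun_cong[OF xy(3), of c] that sub[OF rs(1)] \<open>r = s\<close> by (auto simp: x y \<phi>_def)
    qed
    ultimately show "x = y" by (simp add: x y)
  next
    fix f assume "f \<in> \<phi> ` ?S"
    then obtain r g where f: "f = \<phi> (r, g)" and r: "r \<in> below k p"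
      and g: "g \<in> fillings (cells k m r) (\<lambda>i. b i - 1)" by auto
    have "1 \<le> f c \<and> f c \<le> b (fst c)" if "c \<in> ?P" for c
      using g b[OF that] that by (force simp: f \<phi>_def fillings_def)
    moreover have "f c \<le> f d" if "c \<in> ?P" "d \<in> ?P" "fst c \<le> fst d" "snd c \<le> snd d" for c d
      using upper[OF r, of c d] that g by (auto simp: f \<phi>_def fillings_def)
    ultimately show "f \<in> fillings ?P b" by (auto simp: fillings_def f \<phi>_def)
  next
    fix f assume f: "f \<in> fillings ?P b"
    have f1: "1 \<le> f c" "f c \<le> b (fst c)" if "c \<in> ?P" for c using f that by (auto simp: fillings_def)
    have fm: "f c \<le> f d" if "c \<in> ?P" "d \<in> ?P" "fst c \<le> fst d" "snd c \<le> snd d" for c d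
      using f that unfolding fillings_def by blast
    obtain r where r: "r \<in> below k p" "cells k m r = {c \<in> ?P. 2 \<le> f c}"
    proof (rule upset_eq_cells[OF p, where G = "{c \<in> ?P. 2 \<le> f c}"])
      fix c d assume "c \<in> {c \<in> ?P. 2 \<le> f c}" "d \<in> ?P" "fst c \<le> fst d" "snd c \<le> snd d"
      then show "d \<in> {c \<in> ?P. 2 \<le> f c}" using fm[of c d] by auto
    qed auto
    define g where "g = restrict (\<lambda>c. f c - 1) (cells k m r)"
    have "g \<in> fillings (cells k m r) (\<lambda>i. b i - 1)"
      using f1 fm by (auto simp: g_def fillings_def r(2) diff_le_mono)
    moreover have "\<phi> (r, g) = f"
    proof (rule PiE_ext)
      show "\<phi> (r, g) \<in> ?P \<rightarrow>\<^sub>E UNIV" "f \<in> ?P \<rightarrow>\<^sub>E UNIV"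
        using f by (auto simp: \<phi>_def fillings_def)
      show "\<phi> (r, g) c = f c" if "c \<in> ?P" for c
        using f1(1)[OF that] that by (auto simp: \<phi>_def g_def r(2))
    qed
    ultimately show "f \<in> \<phi> ` ?S" using r(1) by (intro image_eqI[of _ _ "(r, g)"]) auto
  qed
  then show ?thesis
    by (simp add: bij_betw_same_card[symmetric] finite_below finite_fillings finite_cells)
qed

section \<open>Cutting fillings at the levels prescribed by the row bounds\<close>

lemma fillings_bound_0:
  assumes "c \<in> F" "b (fst c) = 0"
  shows "fillings F b = {}"
  using assms by (force simp: fillings_def)

lemma fillings_cong:
  assumes "\<And>c. c \<in> F \<Longrightarrow> b (fst c) = b' (fst c)"
  shows "fillings F b = fillings F b'"
  using assms unfolding fillings_def by (intro Collect_cong conj_cong ball_cong refl) auto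

text \<open>Applying \<open>card_fillings_step\<close> \<open>n\<close> times removes the
  \<open>n\<close> lowest levels, and the chains of shapes passed through are counted by
  \<open>\<Omega>(n)\<close>. Rows before \<open>i\<close> are empty, so their bound 0 is harmless;
  the other bounds are at least 1 before each removal.\<close>

lemma card_fillings_shift:
  fixes b :: "nat \<Rightarrow> nat"
  assumes P: "\<And>l. l < k \<Longrightarrow> P l \<le> m" "\<And>l. l < k \<Longrightarrow> Suc l < i \<Longrightarrow> P l = 0"
    and p: "p \<in> below k P" and b: "\<And>l. l < i \<Longrightarrow> b l = 0"
  shows "rat_of_nat (card (fillings (cells k m p) (\<lambda>l. if l < i then 0 else n + b l)))
    = (\<Sum>r\<in>below k P. poly (skew_poly k p r) (of_nat n) * of_nat (card (fillings (cells k m r) b)))"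
  using p
proof (induction n arbitrary: p)
  case 0
  have "(\<lambda>l. if l < i then 0 else 0 + b l) = b" using b by auto
  moreover have "(\<Sum>r\<in>below k P. poly (skew_poly k p r) (of_nat 0) * of_nat (card (fillings (cells k m r) b)))
      = (\<Sum>r\<in>below k P. if p = r then rat_of_nat (card (fillings (cells k m r) b)) else 0)"
    using 0 by (intro sum.cong) (auto simp: poly_skew_poly_0 below_iff)
  ultimately show ?case using 0 by (simp add: finite_below)
next
  case (Suc n)
  let ?b = "\<lambda>n l. if l < i then 0 else n + b l"
  have p: "p \<in> mono_seqs k" "\<And>l. l < k \<Longrightarrow> p l \<le> P l" using Suc.prems by (auto simp: below_iff)
  have sub: "r \<in> below k P" if "r \<in> below k p" for r
    using that Suc.prems by (meson below_iff order_trans)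
  have row: "i \<le> fst c" if "c \<in> cells k m r" "r \<in> below k P" for c r
  proof (rule ccontr)
    assume "\<not> i \<le> fst c"
    then have "fst c - 1 < k" "Suc (fst c - 1) < i" using that(1) by (auto simp: cells_def)
    then have "r (fst c - 1) = 0" using that(2) P(2)[of "fst c - 1"] by (auto simp: below_iff)
    then show False using that(1) by (auto simp: cells_def)
  qed
  have "card (fillings (cells k m p) (?b (Suc n)))
      = (\<Sum>r\<in>below k p. card (fillings (cells k m r) (\<lambda>l. ?b (Suc n) l - 1)))"
  proof (rule card_fillings_step[OF p(1)])
    show "p l \<le> m" if "l < k" for l using p(2)[OF that] P(1)[OF that] by simp
    show "1 \<le> ?b (Suc n) (fst c)" if "c \<in> cells k m p" for c
      using row[OF that Suc.prems] by simp
  qed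
  also have "\<dots> = (\<Sum>r\<in>below k p. card (fillings (cells k m r) (?b n)))"
    by (intro sum.cong refl arg_cong[where f = card] fillings_cong) auto
  finally have "rat_of_nat (card (fillings (cells k m p) (?b (Suc n))))
      = (\<Sum>r\<in>below k p. rat_of_nat (card (fillings (cells k m r) (?b n))))"
    by simp
  also have "\<dots> = (\<Sum>r\<in>below k p. \<Sum>s\<in>below k P. poly (skew_poly k r s) (of_nat n)
        * of_nat (card (fillings (cells k m s) b)))"
    by (intro sum.cong refl Suc.IH sub)
  also have "\<dots> = (\<Sum>s\<in>below k P. (\<Sum>r\<in>below k p. poly (skew_poly k r s) (of_nat n))
        * of_nat (card (fillings (cells k m s) b)))"
    by (subst sum.swap) (simp add: sum_distrib_right)
  also have "\<dots> = (\<Sum>s\<in>below k P. poly (skew_poly k p s) (of_nat n + 1)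
        * of_nat (card (fillings (cells k m s) b)))"
    unfolding poly_skew_poly_add_one[OF p(1)] ..
  finally show ?case by (simp add: add.commute)
qed

text \<open>What remains of the bound in row \<open>l\<close> once the levels of
  \<open>y 1, ..., y (i - 1)\<close> are removed; for \<open>l < i\<close> the sum is empty.\<close>

definition sum_from :: "(nat \<Rightarrow> nat) \<Rightarrow> nat \<Rightarrow> nat \<Rightarrow> nat" where
  "sum_from y i l = (\<Sum>a = i..l. y a)"

text \<open>The \<open>y i\<close> lowest levels are removed. Afterwards row \<open>i\<close> has
  bound 0, so only shapes in which it is empty contribute; its length is \<open>r (i - 1)\<close>
  because lengths are indexed from 0.\<close>

lemma card_fillings_block:
  assumes P: "P \<in> mono_seqs k" "\<And>l. l < k \<Longrightarrow> P l \<le> m" "\<And>l. l < k \<Longrightarrow> Suc l < i \<Longrightarrow> P l = 0"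
    and i: "1 \<le> i" "i \<le> k"
  shows "rat_of_nat (card (fillings (cells k m P) (sum_from y i)))
    = (\<Sum>r\<in>{r \<in> below k P. r (i - 1) = 0}. poly (skew_poly k P r) (of_nat (y i))
        * of_nat (card (fillings (cells k m r) (sum_from y (Suc i)))))"
proof -
  have "sum_from y i = (\<lambda>l. if l < i then 0 else y i + sum_from y (Suc i) l)"
    by (auto simp: sum_from_def fun_eq_iff sum.atLeast_Suc_atMost)
  then have "rat_of_nat (card (fillings (cells k m P) (sum_from y i)))
    = (\<Sum>r\<in>below k P. poly (skew_poly k P r) (of_nat (y i))
        * of_nat (card (fillings (cells k m r) (sum_from y (Suc i)))))"
    using card_fillings_shift[OF P(2, 3), where p = P and b = "sum_from y (Suc i)" and n = "y i"] P(1)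
    by (simp add: below_iff sum_from_def)
  also have "\<dots> = (\<Sum>r\<in>{r \<in> below k P. r (i - 1) = 0}. poly (skew_poly k P r) (of_nat (y i))
        * of_nat (card (fillings (cells k m r) (sum_from y (Suc i)))))"
  proof (rule sum.mono_neutral_right)
    show "\<forall>r\<in>below k P - {r \<in> below k P. r (i - 1) = 0}. poly (skew_poly k P r) (of_nat (y i))
        * of_nat (card (fillings (cells k m r) (sum_from y (Suc i)))) = 0"
    proof
      fix r assume r: "r \<in> below k P - {r \<in> below k P. r (i - 1) = 0}"
      moreover from this have "r (i - 1) \<le> P (i - 1)" "P (i - 1) \<le> m"
        using P(2)[of "i - 1"] i by (auto simp: below_iff)
      \<comment> \<open>A nonempty row contains its rightmost cell.\<close>
      ultimately have "(i, m) \<in> cells k m r" using i by (auto simp: cells_def)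
      then have "fillings (cells k m r) (sum_from y (Suc i)) = {}"
        by (rule fillings_bound_0) (simp add: sum_from_def)
      then show "poly (skew_poly k P r) (of_nat (y i))
        * of_nat (card (fillings (cells k m r) (sum_from y (Suc i)))) = 0" by simp
    qed
  qed (auto simp: finite_below)
  finally show ?thesis .
qed

text \<open>Downward induction on \<open>i\<close>, the number of leading rows known to be empty. At
  \<open>i = k\<close> only the empty filling is left; each step brings in the variable
  \<open>y (Suc i)\<close> through polynomials with nonnegative coefficients.\<close>

lemma card_fillings_nonneg_poly:
  assumes "i \<le> k" "p \<in> mono_seqs k" "\<And>l. l < k \<Longrightarrow> p l \<le> m" "\<And>l. l < k \<Longrightarrow> l < i \<Longrightarrow> p l = 0"
  shows "\<exists>f. nonneg_poly_fun k f \<and>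
    (\<forall>y. rat_of_nat (card (fillings (cells k m p) (sum_from y (Suc i)))) = f (\<lambda>a. of_nat (y a)))"
  using assms
proof (induction i arbitrary: p rule: inc_induct)
  case base
  then have "cells k m p = {}" by (force simp: cells_def)
  then show ?case using nonneg_poly_fun_1 by (intro exI[of _ "\<lambda>_. 1"]) (auto simp: fillings_empty)
next
  case (step i)
  let ?R = "{r \<in> below k p. r i = 0}"
  have "\<forall>r\<in>?R. \<exists>f. nonneg_poly_fun k f \<and>
    (\<forall>y. rat_of_nat (card (fillings (cells k m r) (sum_from y (Suc (Suc i))))) = f (\<lambda>a. of_nat (y a)))"
  proof
    fix r assume r: "r \<in> ?R"
    have le: "r l \<le> p l" if "l < k" for l using r that by (simp add: below_iff)
    show "\<exists>f. nonneg_poly_fun k f \<and>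
      (\<forall>y. rat_of_nat (card (fillings (cells k m r) (sum_from y (Suc (Suc i))))) = f (\<lambda>a. of_nat (y a)))"
    proof (rule step.IH)
      show "r l \<le> m" if "l < k" for l using le[OF that] step.prems(2)[OF that] by simp
      show "r l = 0" if "l < k" "l < Suc i" for l
        using le[OF that(1)] step.prems(3)[OF that(1)] that(2) r by (cases "l = i") auto
    qed (use r in \<open>simp add: below_iff\<close>)
  qed
  from bchoice[OF this] obtain f where f: "\<And>r. r \<in> ?R \<Longrightarrow> nonneg_poly_fun k (f r)"
    "\<And>r y. r \<in> ?R \<Longrightarrow> rat_of_nat (card (fillings (cells k m r) (sum_from y (Suc (Suc i))))) = f r (\<lambda>a. of_nat (y a))"
    by blast
  show ?case
  proof (intro exI conjI allI)
    show "nonneg_poly_fun k (\<lambda>v. \<Sum>r\<in>?R. poly (skew_poly k p r) (v (Suc i)) * f r v)"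
      using step.hyps step.prems(1) f(1) skew_poly_coeff_nonneg
      by (intro nonneg_poly_fun_sum nonneg_poly_fun_poly_mult) (auto simp: below_iff)
    show "rat_of_nat (card (fillings (cells k m p) (sum_from y (Suc i))))
      = (\<Sum>r\<in>?R. poly (skew_poly k p r) (of_nat (y (Suc i))) * f r (\<lambda>a. of_nat (y a)))" for y
      using card_fillings_block[of p k m "Suc i" y] step.hyps step.prems f(2) by simp
  qed
qed

subsection \<open>Lattice points of the polytope\<close>

lemma full_cells: "cells k m (restrict (\<lambda>_. m) {..<k}) = {1..k} \<times> {1..m}"
  by (auto simp: cells_def)

text \<open>The inequalities between neighbours are chained first along row \<open>i\<close>, then
  along column \<open>j'\<close>.\<close>

lemma PS_int_mono:
  assumes "x \<in> PS k m y" "i \<in> {1..k}" "j \<in> {1..m}" "i' \<in> {1..k}" "j' \<in> {1..m}" "i \<le> i'" "j \<le> j'"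
  shows "x (i, j) \<le> x (i', j')"
proof -
  have "x (i, j) \<le> x (i, j')"
    using assms(7)
  proof (induction rule: dec_induct)
    case (step n)
    then have "x (i, n) \<le> x (i, n + 1)" using assms by (auto simp: PS_def)
    then show ?case using step by simp
  qed simp
  also have "\<dots> \<le> x (i', j')"
    using assms(6)
  proof (induction rule: dec_induct)
    case (step n)
    then have "x (n, j') \<le> x (n + 1, j')" using assms by (auto simp: PS_def)
    then show ?case using step by simp
  qed simp
  finally show ?thesis .
qed

text \<open>Adding 1 to every coordinate turns lattice points into fillings of the full rectangle,
  whose entries start at 1 instead of 0.\<close>

lemma card_PS:
  assumes "m \<ge> 1"
  shows "card (PS k m y \<inter> int_arrays k m) = card (fillings ({1..k} \<times> {1..m}) (\<lambda>i. Suc (psum y i)))"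
proof (rule bij_betw_same_card[OF bij_betwI])
  let ?C = "{1..k} \<times> {1..m}"
  define \<phi> where "\<phi> = (\<lambda>x :: nat \<times> nat \<Rightarrow> real. restrict (\<lambda>c. Suc (nat \<lfloor>x c\<rfloor>)) ?C)"
  define \<psi> where "\<psi> = (\<lambda>f :: nat \<times> nat \<Rightarrow> nat. restrict (\<lambda>c. real (f c) - 1) ?C)"
  have nonneg: "0 \<le> x c" and upper: "x c \<le> real (psum y (fst c))" if "x \<in> PS k m y" "c \<in> ?C" for x c
  proof -
    obtain i j where c: "c = (i, j)" and ij: "i \<in> {1..k}" "j \<in> {1..m}" using \<open>c \<in> ?C\<close> by auto
    have "0 \<le> x (i, 1)" using that(1) ij by (auto simp: PS_def)
    also have "\<dots> \<le> x (i, j)" using ij by (intro PS_int_mono[OF that(1)]) auto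
    finally show "0 \<le> x c" by (simp add: c)
    have "x (i, j) \<le> x (i, m)" using ij by (intro PS_int_mono[OF that(1)]) auto
    also have "\<dots> \<le> real (psum y i)" using that(1) ij by (auto simp: PS_def)
    finally show "x c \<le> real (psum y (fst c))" by (simp add: c)
  qed
  show "\<phi> \<in> PS k m y \<inter> int_arrays k m \<rightarrow> fillings ?C (\<lambda>i. Suc (psum y i))"
  proof
    fix x assume x: "x \<in> PS k m y \<inter> int_arrays k m"
    have "nat \<lfloor>x c\<rfloor> \<le> psum y (fst c)" if "c \<in> ?C" for c
      using upper[of x c] x that by (simp add: nat_le_iff floor_le_iff)
    moreover have "nat \<lfloor>x c\<rfloor> \<le> nat \<lfloor>x d\<rfloor>"
      if "c \<in> ?C" "d \<in> ?C" "fst c \<le> fst d" "snd c \<le> snd d" for c d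
      using PS_int_mono[of x k m y "fst c" "snd c" "fst d" "snd d"] x that
      by (intro nat_mono floor_mono) auto
    ultimately show "\<phi> x \<in> fillings ?C (\<lambda>i. Suc (psum y i))"
      by (auto simp: fillings_def \<phi>_def)
  qed
  show "\<psi> \<in> fillings ?C (\<lambda>i. Suc (psum y i)) \<rightarrow> PS k m y \<inter> int_arrays k m"
  proof
    fix f assume f: "f \<in> fillings ?C (\<lambda>i. Suc (psum y i))"
    have f1: "1 \<le> f (i, j)" "f (i, j) \<le> Suc (psum y i)" if "i \<in> {1..k}" "j \<in> {1..m}" for i j
      using f that by (force simp: fillings_def)+
    have fm: "f (i, j) \<le> f (i', j')"
      if "i \<in> {1..k}" "j \<in> {1..m}" "i' \<in> {1..k}" "j' \<in> {1..m}" "i \<le> i'" "j \<le> j'" for i j i' j'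
      using f that by (force simp: fillings_def)
    have "\<psi> f \<in> int_arrays k m" by (auto simp: \<psi>_def int_arrays_def)
    moreover have "\<psi> f \<in> PS k m y"
      unfolding PS_def
    proof (intro CollectI conjI ballI)
      show "\<psi> f \<in> real_arrays k m" by (auto simp: \<psi>_def real_arrays_def)
    next
      fix i assume i: "i \<in> {1..k}"
      show "0 \<le> \<psi> f (i, 1)" using f1(1)[OF i, of 1] i assms by (simp add: \<psi>_def)
      show "\<psi> f (i, m) \<le> real (psum y i)" using f1(2)[OF i, of m] i assms by (simp add: \<psi>_def)
      fix j assume "j \<in> {1..<m}"
      then show "\<psi> f (i, j) \<le> \<psi> f (i, j + 1)" using fm[of i j i "j + 1"] i by (simp add: \<psi>_def)
    next
      fix i j assume "i \<in> {1..<k}" "j \<in> {1..m}"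
      then show "\<psi> f (i, j) \<le> \<psi> f (i + 1, j)" using fm[of i j "i + 1" j] by (simp add: \<psi>_def)
    qed
    ultimately show "\<psi> f \<in> PS k m y \<inter> int_arrays k m" by simp
  qed
  show "\<psi> (\<phi> x) = x" if x: "x \<in> PS k m y \<inter> int_arrays k m" for x
  proof (rule PiE_ext)
    show "\<psi> (\<phi> x) \<in> ?C \<rightarrow>\<^sub>E UNIV" "x \<in> ?C \<rightarrow>\<^sub>E UNIV"
      using x by (auto simp: \<psi>_def PS_def real_arrays_def)
    show "\<psi> (\<phi> x) c = x c" if "c \<in> ?C" for c
    proof -
      have "x c \<in> \<int>" using x that by (auto simp: int_arrays_def)
      then have "real (nat \<lfloor>x c\<rfloor>) = x c" using nonneg[of x c] x that by (auto elim: Ints_cases)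
      then show ?thesis using that by (simp add: \<psi>_def \<phi>_def)
    qed
  qed
  show "\<phi> (\<psi> f) = f" if f: "f \<in> fillings ?C (\<lambda>i. Suc (psum y i))" for f
  proof (rule PiE_ext)
    show "\<phi> (\<psi> f) \<in> ?C \<rightarrow>\<^sub>E UNIV" "f \<in> ?C \<rightarrow>\<^sub>E UNIV"
      using f by (auto simp: \<phi>_def fillings_def)
    show "\<phi> (\<psi> f) c = f c" if "c \<in> ?C" for c
    proof -
      have "1 \<le> f c" using f that unfolding fillings_def by blast
      then have "\<lfloor>real (f c) - 1\<rfloor> = int (f c) - 1" by simp
      then show ?thesis using \<open>1 \<le> f c\<close> that by (simp add: \<phi>_def \<psi>_def)
    qed
  qed
qed

theorem theorem3p3:
  fixes k m :: nat
  assumes "k \<ge> 1" and "m \<ge> 1"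
  shows "\<exists>p \<in> rat_polys k.
    (\<forall>t. Poly_Mapping.lookup p t \<ge> 0) \<and>
    (\<forall>y :: nat \<Rightarrow> nat. of_nat (card (PS k m y \<inter> int_arrays k m)) = eval_mpoly p (\<lambda>i. of_nat (y i)))"
proof -
  let ?m = "restrict (\<lambda>_. m) {..<k}"
  have m: "?m \<in> mono_seqs k" by (auto simp: mono_seqs_def intro: mono_onI)
  have r: "r \<in> mono_seqs k" "r l \<le> m" if "r \<in> below k ?m" "l < k" for r l
    using that by (auto simp: below_iff)
  \<comment> \<open>The bounds exceed the partial sums by one. Removing that extra level leaves the
    shape \<open>r\<close> of positive coordinates, which ranges freely below the rectangle, with
    bounds \<open>y 1 + ... + y i\<close>.\<close>
  have count: "rat_of_nat (card (PS k m y \<inter> int_arrays k m))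
      = (\<Sum>r\<in>below k ?m. rat_of_nat (card (fillings (cells k m r) (sum_from y (Suc 0)))))" for y
  proof -
    have "(\<lambda>i. Suc (psum y i) - 1) = sum_from y (Suc 0)"
      by (auto simp: psum_def sum_from_def)
    then show ?thesis
      using card_fillings_step[OF m, of m "\<lambda>i. Suc (psum y i)"]
      by (simp add: card_PS[OF assms(2)] full_cells)
  qed
  have "\<forall>r\<in>below k ?m. \<exists>f. nonneg_poly_fun k f \<and>
    (\<forall>y. rat_of_nat (card (fillings (cells k m r) (sum_from y (Suc 0)))) = f (\<lambda>a. of_nat (y a)))"
    using r by (intro ballI card_fillings_nonneg_poly) (auto simp: below_iff)
  from bchoice[OF this] obtain f where f: "\<And>r. r \<in> below k ?m \<Longrightarrow> nonneg_poly_fun k (f r)"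
    "\<And>r y. r \<in> below k ?m \<Longrightarrow>
      rat_of_nat (card (fillings (cells k m r) (sum_from y (Suc 0)))) = f r (\<lambda>a. of_nat (y a))"
    by blast
  have "nonneg_poly_fun k (\<lambda>v. \<Sum>r\<in>below k ?m. f r v)"
    using f(1) by (rule nonneg_poly_fun_sum)
  then obtain p where "p \<in> rat_polys k" "\<forall>t. Poly_Mapping.lookup p t \<ge> 0"
    "\<And>v. (\<Sum>r\<in>below k ?m. f r v) = eval_mpoly p v"
    unfolding nonneg_poly_fun_def by blast
  then show ?thesis
    by (intro bexI[of _ p]) (simp_all add: count f(2))
qed

end
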